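(* The index $RIC$ does not satisfy the axiom of monotonicity under intensification of preferences: it is not true that for every order $n\ge 2$, every reciprocal matrix $A=(a_{ij})\in M_R$ of order $n$ and every real $b>1$ one has $RIC(A^{b})\ge RIC(A)$, where $A^{b}$ denotes the matrix with entries $a_{ij}^{b}$. That is, there exist $n\ge2$, $A\in M_R$ of order $n$ and $b>1$ with $RIC(A^{b})<RIC(A)$.
   Context: $M_R$ is the set of all real $n\times n$ matrices $A=(a_{ij})$ with $a_{ij}>0$ for all $i,j$ and $a_{ij}=1/a_{ji}$ for all $i,j$ (reciprocal matrices). The power $A^{b}=(a_{ij}^{b})$ is taken entrywise. For $A\in M_R$ let $r_i=(a_{i1},\dots,a_{in})$ be its $i$-th row, let $\varphi_{ij}$ be the angle between $r_i$ and $r_j$, so $\cos\varphi_{ij}=\frac{r_i\cdot r_j}{|r_i|\,|r_j|}$ (Euclidean dot product and norm). The row inconsistency index is $RIC(A)=1-\frac{2\sum_{i=1}^{n-1}\sum_{j=i+1}^{n}\cos\varphi_{ij}}{n(n-1)}$. *)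

theory Defs
  imports Complex_Main "HOL-Analysis.L2_Norm" "Jordan_Normal_Form.Matrix"
begin

(* Matrices are those of Jordan_Normal_Form, so rows and columns are numbered 0..n-1, and the
   order n is a natural number that can be quantified over. *)

definition reciprocal_matrices :: "nat \<Rightarrow> real mat set" where
  "reciprocal_matrices n =
     {A \<in> carrier_mat n n.
        \<forall>i<n. \<forall>j<n. A $$ (i, j) > 0 \<and> A $$ (i, j) = 1 / A $$ (j, i)}"

definition entrywise_powr :: "real mat \<Rightarrow> real \<Rightarrow> real mat" where
  "entrywise_powr A b = map_mat (\<lambda>x. x powr b) A"

definition euclidean_norm_vec :: "real vec \<Rightarrow> real" where
  "euclidean_norm_vec v = sqrt (v \<bullet> v)"

(* For the zero vector the quotient is 0 by convention; rows of reciprocal matrices are nonzero. *)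
definition vec_angle :: "real vec \<Rightarrow> real vec \<Rightarrow> real" where
  "vec_angle v w = arccos ((v \<bullet> w) / (euclidean_norm_vec v * euclidean_norm_vec w))"

lemma cos_vec_angle:
  assumes "dim_vec v = dim_vec w"
  shows "cos (vec_angle v w) = (v \<bullet> w) / (euclidean_norm_vec v * euclidean_norm_vec w)"
proof -
  let ?I = "{0..<dim_vec w}"
  have v: "euclidean_norm_vec v = L2_set (($) v) ?I"
    by (simp add: euclidean_norm_vec_def scalar_prod_def L2_set_def power2_eq_square assms)
  have w: "euclidean_norm_vec w = L2_set (($) w) ?I"
    by (simp add: euclidean_norm_vec_def scalar_prod_def L2_set_def power2_eq_square)
  have "\<bar>v \<bullet> w\<bar> \<le> (\<Sum>i\<in>?I. \<bar>v $ i\<bar> * \<bar>w $ i\<bar>)"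
    unfolding scalar_prod_def by (rule order_trans[OF sum_abs]) (simp add: abs_mult)
  also have "\<dots> \<le> euclidean_norm_vec v * euclidean_norm_vec w"
    unfolding v w by (rule L2_set_mult_ineq)
  finally have le: "\<bar>v \<bullet> w\<bar> \<le> euclidean_norm_vec v * euclidean_norm_vec w" .
  have "0 \<le> euclidean_norm_vec v * euclidean_norm_vec w"
    unfolding v w by (intro mult_nonneg_nonneg L2_set_nonneg)
  with le have "\<bar>(v \<bullet> w) / (euclidean_norm_vec v * euclidean_norm_vec w)\<bar> \<le> 1"
    by (simp only: abs_divide abs_of_nonneg divide_le_eq_1) (metis order_le_less)
  then show ?thesis
    by (simp add: vec_angle_def cos_arccos_abs)
qed

definition RIC :: "real mat \<Rightarrow> real" where
  "RIC A =
     (let n = dim_row A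
      in 1 - 2 * (\<Sum>i = 0..<n - 1. \<Sum>j = i + 1..<n. cos (vec_angle (row A i) (row A j)))
             / (real n * (real n - 1)))"

definition monotone_under_intensification :: "(real mat \<Rightarrow> real) \<Rightarrow> bool" where
  "monotone_under_intensification I \<longleftrightarrow>
     (\<forall>n\<ge>2. \<forall>A\<in>reciprocal_matrices n. \<forall>b>1. I (entrywise_powr A b) \<ge> I A)"

end

theory Submission
  imports Defs
begin

text \<open>
  As \<open>b\<close> grows, each row of \<open>A\<^sup>b\<close> is dominated by its largest entry. If the largest entry of every
  row lies in the same column, all rows of \<open>A\<^sup>b\<close> become nearly parallel, so \<open>RIC (A\<^sup>b)\<close> tends
  to \<open>0\<close>; an inconsistent \<open>A\<close> of this kind has \<open>RIC A > 0\<close>. In the matrix below the third column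
  dominates, and \<open>b = 4\<close> is already large enough.
\<close>

text \<open>Inconsistent because 3 * 8 differs from 4, so the rows are not all proportional.\<close>

definition col_dominant_mat :: "real mat" where
  "col_dominant_mat = mat 3 3 (\<lambda>(i, j). [[1, 3, 4], [1/3, 1, 8], [1/4, 1/8, 1]] ! i ! j)"

lemma less_3_cases: "(i::nat) < 3 \<longleftrightarrow> i = 0 \<or> i = 1 \<or> i = 2"
  by auto

lemma col_dominant_mat_reciprocal: "col_dominant_mat \<in> reciprocal_matrices 3"
  by (auto simp: reciprocal_matrices_def col_dominant_mat_def less_3_cases)

lemma entrywise_powr_col_dominant_mat:
  "entrywise_powr col_dominant_mat 4 =
     mat 3 3 (\<lambda>(i, j). [[1, 81, 256], [1/81, 1, 4096], [1/256, 1/4096, 1]] ! i ! j)"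
  by (rule eq_matI)
    (auto simp: entrywise_powr_def col_dominant_mat_def less_3_cases
      power_divide)

lemma cos_vec_angle_sqrt:
  assumes "dim_vec v = dim_vec w"
  shows "cos (vec_angle v w) = (v \<bullet> w) / sqrt ((v \<bullet> v) * (w \<bullet> w))"
  by (simp add: cos_vec_angle[OF assms] euclidean_norm_vec_def real_sqrt_mult)

text \<open>Squaring removes the norms' square roots: for rational vectors and rational
  \<open>c\<close>, the last premise is an exact rational inequality.\<close>

lemma cos_vec_angle_le:
  assumes "dim_vec v = dim_vec w" "0 < (v \<bullet> v) * (w \<bullet> w)" "0 \<le> c"
    and "(v \<bullet> w)\<^sup>2 \<le> c\<^sup>2 * ((v \<bullet> v) * (w \<bullet> w))"
  shows "cos (vec_angle v w) \<le> c"
proof -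
  have "v \<bullet> w \<le> sqrt (c\<^sup>2 * ((v \<bullet> v) * (w \<bullet> w)))"
    using assms(4) by (rule real_le_rsqrt)
  also have "\<dots> = c * sqrt ((v \<bullet> v) * (w \<bullet> w))"
    using assms(3) by (simp only: real_sqrt_mult real_sqrt_abs abs_of_nonneg)
  finally show ?thesis
    using assms(2) by (simp only: cos_vec_angle_sqrt[OF assms(1)] pos_divide_le_eq real_sqrt_gt_zero)
qed

text \<open>Here squaring loses the sign of the dot product, hence the third premise;
  \<open>c\<close> may have any sign.\<close>

lemma cos_vec_angle_ge:
  assumes "dim_vec v = dim_vec w" "0 < (v \<bullet> v) * (w \<bullet> w)" "0 \<le> v \<bullet> w"
    and "c\<^sup>2 * ((v \<bullet> v) * (w \<bullet> w)) \<le> (v \<bullet> w)\<^sup>2"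
  shows "c \<le> cos (vec_angle v w)"
proof -
  \<comment> \<open>The root of the square of \<open>c\<close> is its absolute value.\<close>
  have "c * sqrt ((v \<bullet> v) * (w \<bullet> w)) \<le> \<bar>c\<bar> * sqrt ((v \<bullet> v) * (w \<bullet> w))"
    using assms(2) by (intro mult_right_mono) auto
  also have "\<dots> = sqrt (c\<^sup>2 * ((v \<bullet> v) * (w \<bullet> w)))"
    by (simp only: real_sqrt_mult real_sqrt_abs)
  also have "\<dots> \<le> v \<bullet> w"
    using assms(4,3) by (rule real_le_lsqrt[rotated 1])
  finally show ?thesis
    using assms(2) by (simp only: cos_vec_angle_sqrt[OF assms(1)] pos_le_divide_eq real_sqrt_gt_zero)
qed

lemma RIC_order_3:
  assumes "dim_row A = 3"
  shows "RIC A = 1 - (cos (vec_angle (row A 0) (row A 1)) + cos (vec_angle (row A 0) (row A 2))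
    + cos (vec_angle (row A 1) (row A 2))) / 3"
  using assms by (simp add: RIC_def Let_def numeral_2_eq_2 numeral_3_eq_3)

lemma row_scalar_prod_order_3:
  assumes "A \<in> carrier_mat 3 3" "i < 3" "j < 3"
  shows "row A i \<bullet> row A j = A $$ (i, 0) * A $$ (j, 0) + A $$ (i, 1) * A $$ (j, 1)
    + A $$ (i, 2) * A $$ (j, 2)"
  using assms by (simp add: scalar_prod_def numeral_3_eq_3 numeral_2_eq_2)

text \<open>The cosines are about 0.859, 0.874 and 0.980; their upper bounds 0.86, 0.88 and 0.98 add
  up to 2.72.\<close>

lemma RIC_col_dominant_mat: "RIC col_dominant_mat \<ge> 1 - 2.72 / 3"
proof -
  let ?A = col_dominant_mat
  have A: "?A \<in> carrier_mat 3 3"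
    by (simp add: col_dominant_mat_def)
  note rows = row_scalar_prod_order_3[OF A] carrier_matD[OF A]
  \<comment> \<open>The dot products are expanded while the matrix is still folded, so that
    \<open>rows\<close> matches; only then are the entries inserted.\<close>
  have "cos (vec_angle (row ?A 0) (row ?A 1)) \<le> 0.86"
    by (rule cos_vec_angle_le; simp add: rows; simp add: col_dominant_mat_def power2_eq_square)
  moreover have "cos (vec_angle (row ?A 0) (row ?A 2)) \<le> 0.88"
    by (rule cos_vec_angle_le; simp add: rows; simp add: col_dominant_mat_def power2_eq_square)
  moreover have "cos (vec_angle (row ?A 1) (row ?A 2)) \<le> 0.98"
    by (rule cos_vec_angle_le; simp add: rows; simp add: col_dominant_mat_def power2_eq_square)
  ultimately show ?thesis
    using A by (simp add: RIC_order_3)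
qed

text \<open>The cosines are now about 0.953, 0.953 and nearly 1; the lower bounds add up to
  2.89.\<close>

lemma RIC_entrywise_powr_col_dominant_mat:
  "RIC (entrywise_powr col_dominant_mat 4) \<le> 1 - 2.89 / 3"
proof -
  let ?A = "entrywise_powr col_dominant_mat 4"
  have A: "?A \<in> carrier_mat 3 3"
    by (simp add: entrywise_powr_col_dominant_mat)
  note rows = row_scalar_prod_order_3[OF A] carrier_matD[OF A]
  have "0.95 \<le> cos (vec_angle (row ?A 0) (row ?A 1))"
    by (rule cos_vec_angle_ge; simp add: rows; simp add: entrywise_powr_col_dominant_mat power2_eq_square)
  moreover have "0.95 \<le> cos (vec_angle (row ?A 0) (row ?A 2))"
    by (rule cos_vec_angle_ge; simp add: rows; simp add: entrywise_powr_col_dominant_mat power2_eq_square)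
  moreover have "0.99 \<le> cos (vec_angle (row ?A 1) (row ?A 2))"
    by (rule cos_vec_angle_ge; simp add: rows; simp add: entrywise_powr_col_dominant_mat power2_eq_square)
  ultimately show ?thesis
    using A by (simp add: RIC_order_3)
qed

theorem proposition8:
  shows "\<not> monotone_under_intensification RIC"
proof
  assume "monotone_under_intensification RIC"
  then have "RIC col_dominant_mat \<le> RIC (entrywise_powr col_dominant_mat 4)"
    unfolding monotone_under_intensification_def
    by (elim allE[of _ 3] impE ballE[of _ _ col_dominant_mat] allE[of _ 4])
      (simp_all add: col_dominant_mat_reciprocal)
  \<comment> \<open>The two bounds contradict monotonicity since 2.72 < 2.89.\<close>
  with RIC_col_dominant_mat RIC_entrywise_powr_col_dominant_mat show False
    by simp
qed

end
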